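(* Let $p\ge 1$ be real and let $n$ be the dimension. There exist constants $M=M(n,p)$ and $c=c(n,p)$, depending only on $n$ and $p$, such that the following holds. Let $f$ be a smooth solution to the heat equation $\frac{\partial}{\partial t}f=\Delta f$ on $B_2(0)\times[0,1]$, where $B_2(0)\subset\mathbb{R}^n$, satisfying $$f(x,t)\,t^p\le 1\quad\text{for all }(x,t)\in B_1(0)\times[0,1],$$ $$f(x,t)\ge 0\quad\text{for all }x\in B_2(0),\ t\in[0,1],$$ $$\sup_{x\in\overline{B}_1(0)}(f(x,0)+1)^{1/p}(1-|x|^2)^2\le 2.$$ Then $$\sup_{x\in\overline{B}_1(0)}(f(x,t)+1)^{1/p}\big((1-|x|^2)^2-M(n,p)\,t\big)\le c(n,p)\qquad\text{for all }t\in[0,1].$$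
   Context: $B_r(0)$ is the open Euclidean ball of radius $r$ centred at the origin of $\mathbb{R}^n$, $\overline{B}_r(0)$ its closure, $|x|$ the Euclidean norm, and $\Delta$ the standard Laplacian on $\mathbb{R}^n$ in the space variable. *)

theory Defs
  imports "HOL-Analysis.Analysis"
begin

text \<open>
  Differentiability is taken relative to \<open>S\<close>, so it is one-sided at boundary points that belong
  to \<open>S\<close>. This is the usual notion when \<open>S\<close> is contained in the closure of its interior and
  locally convex (for instance an open set times a compact interval), where derivatives within
  \<open>S\<close> are unique. It is not meant for sets with empty interior.
\<close>

fun Ck_on :: "nat \<Rightarrow> 'a::euclidean_space set \<Rightarrow> ('a \<Rightarrow> real) \<Rightarrow> bool" where
  "Ck_on 0 S f \<longleftrightarrow> continuous_on S f"
| "Ck_on (Suc k) S f \<longleftrightarrow>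
     (\<exists>f'. (\<forall>z\<in>S. (f has_derivative f' z) (at z within S)) \<and> (\<forall>v. Ck_on k S (\<lambda>z. f' z v)))"

definition smooth_on :: "'a::euclidean_space set \<Rightarrow> ('a \<Rightarrow> real) \<Rightarrow> bool" where
  "smooth_on S f \<longleftrightarrow> (\<forall>k. Ck_on k S f)"

definition laplacian :: "('a::euclidean_space \<Rightarrow> real) \<Rightarrow> 'a \<Rightarrow> real" where
  "laplacian g x = (\<Sum>b\<in>Basis. (deriv ^^ 2) (\<lambda>s. g (x + s *\<^sub>R b)) 0)"

text \<open>The time derivative is one-sided at the end points of the time interval \<open>T\<close>.\<close>

definition smooth_heat_solution ::
  "'a::euclidean_space set \<Rightarrow> real set \<Rightarrow> ('a \<Rightarrow> real \<Rightarrow> real) \<Rightarrow> bool" where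
  "smooth_heat_solution U T f \<longleftrightarrow>
     smooth_on (U \<times> T) (\<lambda>(x, t). f x t) \<and>
     (\<forall>x\<in>U. \<forall>t\<in>T.
        ((\<lambda>s. f x s) has_real_derivative laplacian (\<lambda>y. f y t) x) (at t within T))"

end

theory Submission imports Defs begin

text \<open>
  Put \<open>F = f + 1\<close>, \<open>\<eta> = (1 - |x|\<^sup>2)\<^sup>2 - M t\<close> and \<open>u = F\<^bsup>1/p\<^esup> \<eta>\<close>; the estimate is a maximum principle for
  \<open>u\<close> on the compact cylinder over the closed unit ball. Suppose that the maximum of \<open>u\<close> exceeds
  \<open>c = 2 M\<close>. It is attained where \<open>\<eta> > 0\<close>, hence over the open ball, and at a positive time because
  of the bound on the initial values. There \<open>ln F + p ln \<eta>\<close> has vanishing gradient and nonpositive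
  second derivatives in space and a nonnegative derivative in time
  (\<open>log_second_derivative_le\<close>, \<open>left_max_derivative_nonneg\<close>). Together with \<open>F\<^sub>t = \<Delta>F\<close> this gives
  \<open>M \<le> (p + 1) |\<nabla>\<eta>|\<^sup>2 / \<eta> - \<Delta>\<eta>\<close>.

  Here \<open>-\<Delta>\<eta> \<le> 4 n\<close> and \<open>|\<nabla>\<eta>|\<^sup>2 = 16 |x|\<^sup>2 (\<eta> + M t)\<close>, so only the quotient \<open>M t / \<eta>\<close> is dangerous,
  and this is where the decay hypothesis enters: \<open>f t\<^bsup>p\<^esup> \<le> 1\<close> gives \<open>F\<^bsup>1/p\<^esup> t \<le> 2\<close>
  (\<open>decay_root_le\<close>), whence \<open>2 M t < u t \<le> 2 \<eta>\<close> and \<open>M t / \<eta> < 1\<close>. Therefore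
  \<open>M \<le> 32 (p + 1) + 4 n\<close>, which fails for \<open>M = 32 (p + 1) + 4 n + 1\<close>.
\<close>

section \<open>Necessary conditions at a maximum on the line\<close>

lemma second_derivative_nonpos_at_max:
  fixes h :: "real \<Rightarrow> real"
  assumes h: "\<forall>\<^sub>F s in nhds a. (h has_real_derivative h' s) (at s)"
    and h': "(h' has_real_derivative d) (at a)"
    and max: "\<forall>\<^sub>F s in nhds a. h s \<le> h a"
  shows "h' a = 0" and "d \<le> 0"
proof -
  obtain e where e: "e > 0" "\<And>s. dist s a < e \<Longrightarrow> (h has_real_derivative h' s) (at s) \<and> h s \<le> h a"
    using eventually_conj[OF h max] unfolding eventually_nhds_metric by blast
  show h0: "h' a = 0"
    by (rule DERIV_local_max[of h "h' a" a e]) (use e in \<open>auto simp: dist_real_def abs_minus_commute\<close>)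
  show "d \<le> 0"
  proof (rule ccontr)
    assume "\<not> d \<le> 0"
    then obtain k where k: "k > 0" "\<And>s. s > 0 \<Longrightarrow> s < k \<Longrightarrow> h' a < h' (a + s)"
      using has_real_derivative_pos_inc_right[OF h'] by auto
    define s where "s = min e k / 2"
    have s: "0 < s" "s < e" "s < k" using e(1) k(1) by (auto simp: s_def)
    have "h a < h (a + s)"
    proof (rule DERIV_pos_imp_increasing_open[of a "a + s"])
      show "a < a + s" using s by simp
      show "\<exists>y. (h has_real_derivative y) (at x) \<and> 0 < y" if "a < x" "x < a + s" for x
        using e(2)[of x] k(2)[of "x - a"] that s h0 by (auto simp: dist_real_def)
      show "continuous_on {a..a + s} h"
      proof (intro continuous_at_imp_continuous_on ballI)
        fix x assume "x \<in> {a..a + s}"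
        then have "(h has_real_derivative h' x) (at x)" using e(2)[of x] s by (auto simp: dist_real_def)
        then show "isCont h x" by (rule DERIV_isCont)
      qed
    qed
    moreover have "h (a + s) \<le> h a" using e(2)[of "a + s"] s by (auto simp: dist_real_def)
    ultimately show False by simp
  qed
qed

lemma left_max_derivative_nonneg:
  fixes h :: "real \<Rightarrow> real"
  assumes h: "(h has_real_derivative d) (at b within {a..c})"
    and ab: "a < b" "b \<le> c"
    and max: "\<forall>\<^sub>F s in at b within {a..c}. h s \<le> h b"
  shows "d \<ge> 0"
proof (rule ccontr)
  assume "\<not> d \<ge> 0"
  then obtain k where k: "k > 0" "\<And>s. s > 0 \<Longrightarrow> b - s \<in> {a..c} \<Longrightarrow> s < k \<Longrightarrow> h b < h (b - s)"
    using has_real_derivative_neg_dec_left[OF h] by auto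
  obtain e where e: "e > 0" "\<And>s. s \<in> {a..c} \<Longrightarrow> s \<noteq> b \<Longrightarrow> dist s b < e \<Longrightarrow> h s \<le> h b"
    using max unfolding eventually_at by blast
  define s where "s = min (min e k) (b - a) / 2"
  have s: "0 < s" "s < e" "s < k" "s < b - a" using e(1) k(1) ab by (auto simp: s_def min_def)
  show False using k(2)[of s] e(2)[of "b - s"] s ab by (auto simp: dist_real_def)
qed

lemma isCont_eventually_pos:
  fixes h :: "'a::t2_space \<Rightarrow> real"
  assumes "isCont h a" "h a > 0"
  shows "\<forall>\<^sub>F s in nhds a. h s > 0"
  using assms order_tendstoD(1) unfolding continuous_at tendsto_at_iff_tendsto_nhds by blast

text \<open>
  At a maximum of \<open>ln \<phi> + p ln e\<close> the first-order condition \<open>\<phi>'/\<phi> = - p e'/e\<close> removes \<open>\<phi>'\<close> from the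
  second-order condition. Summed over the coordinate directions this is a bound on \<open>\<Delta>F / F\<close>
  by the cutoff alone.
\<close>

lemma log_second_derivative_le:
  fixes \<phi> e :: "real \<Rightarrow> real"
  assumes \<phi>: "\<forall>\<^sub>F s in nhds 0. (\<phi> has_real_derivative \<phi>' s) (at s)"
    and \<phi>': "(\<phi>' has_real_derivative \<phi>2) (at 0)"
    and e: "\<And>s. (e has_real_derivative e' s) (at s)"
    and e': "(e' has_real_derivative e2) (at 0)"
    and pos: "\<phi> 0 > 0" "e 0 > 0"
    and max: "\<forall>\<^sub>F s in nhds 0. ln (\<phi> s) + p * ln (e s) \<le> ln (\<phi> 0) + p * ln (e 0)"
  shows "\<phi>2 / \<phi> 0 \<le> (p\<^sup>2 + p) * (e' 0 / e 0)\<^sup>2 - p * e2 / e 0"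
proof -
  have \<phi>0: "(\<phi> has_real_derivative \<phi>' 0) (at 0)"
    using eventually_nhds_x_imp_x[OF \<phi>] .
  have c: "isCont \<phi> 0" "isCont e 0"
    using DERIV_isCont[OF \<phi>0] DERIV_isCont[OF e] by auto
  have ev: "\<forall>\<^sub>F s in nhds 0. \<phi> s > 0 \<and> e s > 0"
    by (intro eventually_conj isCont_eventually_pos c pos)
  define h where "h = (\<lambda>s. ln (\<phi> s) + p * ln (e s))"
  define h' where "h' = (\<lambda>s. \<phi>' s / \<phi> s + p * (e' s / e s))"
  have 1: "\<forall>\<^sub>F s in nhds 0. (h has_real_derivative h' s) (at s)"
    using \<phi> ev
  proof eventually_elim
    case (elim s)
    then show ?case unfolding h_def h'_def
      by (auto intro!: derivative_eq_intros e)
  qed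
  have 2: "(h' has_real_derivative
      (\<phi>2 * \<phi> 0 - \<phi>' 0 * \<phi>' 0) / (\<phi> 0 * \<phi> 0) + p * ((e2 * e 0 - e' 0 * e' 0) / (e 0 * e 0))) (at 0)"
    unfolding h'_def using pos
    by (auto intro!: derivative_eq_intros \<phi>0 \<phi>' e e' simp: algebra_simps)
  have mx: "\<forall>\<^sub>F s in nhds 0. h s \<le> h 0" using max by (simp add: h_def)
  note T = second_derivative_nonpos_at_max[OF 1 2 mx]
  have A: "\<phi>' 0 / \<phi> 0 = - (p * (e' 0 / e 0))" using T(1) by (simp add: h'_def)
  have "(\<phi>2 * \<phi> 0 - \<phi>' 0 * \<phi>' 0) / (\<phi> 0 * \<phi> 0) + p * ((e2 * e 0 - e' 0 * e' 0) / (e 0 * e 0))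
     = \<phi>2 / \<phi> 0 - (\<phi>' 0 / \<phi> 0)\<^sup>2 + p * e2 / e 0 - p * (e' 0 / e 0)\<^sup>2"
    using pos by (simp add: field_simps power2_eq_square)
  then have "\<phi>2 / \<phi> 0 \<le> (\<phi>' 0 / \<phi> 0)\<^sup>2 - p * e2 / e 0 + p * (e' 0 / e 0)\<^sup>2"
    using T(2) by linarith
  then show ?thesis unfolding A by (simp only: power2_minus power_mult_distrib) (simp add: distrib_right)
qed

section \<open>Restriction to lines, the cutoff and the decay bound\<close>

text \<open>
  The time may be an end point of the interval, where the derivative is only one-sided; along a
  spatial line through a point of the open set it is nevertheless a two-sided derivative, and the
  iterated derivative of the restriction is a true second derivative.
\<close>

lemma Ck_on_spatial_line:
  fixes f :: "'a::euclidean_space \<Rightarrow> real \<Rightarrow> real"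
  assumes C: "Ck_on 2 (U \<times> T) (\<lambda>(x, t). f x t)" and U: "open U" "x \<in> U" and t: "t \<in> T"
  obtains \<phi>' where "\<forall>\<^sub>F s in nhds 0. ((\<lambda>s. f (x + s *\<^sub>R b) t) has_real_derivative \<phi>' s) (at s)"
    and "(\<phi>' has_real_derivative (deriv ^^ 2) (\<lambda>s. f (x + s *\<^sub>R b) t) 0) (at 0)"
proof -
  define V where "V = (\<lambda>s::real. x + s *\<^sub>R b) -` U"
  have V: "open V" unfolding V_def by (intro open_vimage U continuous_intros)
  have V0: "0 \<in> V" using U by (simp add: V_def)
  have chain: "((\<lambda>s. g (x + s *\<^sub>R b, t)) has_real_derivative g' (b, 0)) (at s)"
    if g: "(g has_derivative g') (at (x + s *\<^sub>R b, t) within U \<times> T)" and s: "s \<in> V"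
    for g :: "'a \<times> real \<Rightarrow> real" and g' s
  proof -
    interpret g': bounded_linear g' using g by (rule has_derivative_bounded_linear)
    have "((\<lambda>s. (x + s *\<^sub>R b, t)) has_derivative (\<lambda>h. (h *\<^sub>R b, 0))) (at s within V)"
      by (auto intro!: derivative_eq_intros)
    moreover have "(g has_derivative g') (at (x + s *\<^sub>R b, t) within (\<lambda>s. (x + s *\<^sub>R b, t)) ` V)"
      by (rule has_derivative_subset[OF g]) (auto simp: V_def t)
    ultimately have "((\<lambda>s. g (x + s *\<^sub>R b, t)) has_derivative (\<lambda>h. g' (h *\<^sub>R b, 0))) (at s within V)"
      by (rule has_derivative_in_compose)
    moreover have "(\<lambda>h. g' (h *\<^sub>R b, 0)) = (*) (g' (b, 0))"
    proof
      show "g' (h *\<^sub>R b, 0) = g' (b, 0) * h" for h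
        using g'.scaleR[of h "(b, 0)"] by simp
    qed
    ultimately show ?thesis
      unfolding has_field_derivative_def at_within_open[OF s V] by simp
  qed
  let ?F = "\<lambda>(x, t). f x t" and ?\<phi> = "\<lambda>s. f (x + s *\<^sub>R b) t"
  obtain f' where f': "\<And>z. z \<in> U \<times> T \<Longrightarrow> (?F has_derivative f' z) (at z within U \<times> T)"
    and C1: "Ck_on 1 (U \<times> T) (\<lambda>z. f' z (b, 0))"
    using C unfolding numeral_2_eq_2 One_nat_def Ck_on.simps(2)[of "Suc 0"] by blast
  obtain f'' where f'': "\<And>z. z \<in> U \<times> T \<Longrightarrow>
      ((\<lambda>z. f' z (b, 0)) has_derivative f'' z) (at z within U \<times> T)"
    using C1 unfolding One_nat_def Ck_on.simps(2)[of 0] by blast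
  define \<phi>' where "\<phi>' = (\<lambda>s. f' (x + s *\<^sub>R b, t) (b, 0))"
  have 1: "(?\<phi> has_real_derivative \<phi>' s) (at s)" if "s \<in> V" for s
    using chain[OF f' that] that t by (simp add: V_def \<phi>'_def)
  have 2: "(\<phi>' has_real_derivative f'' (x, t) (b, 0)) (at 0)"
    using chain[OF f'' V0] U t by (simp add: \<phi>'_def)
  have near: "\<forall>\<^sub>F s in nhds 0. s \<in> V" using V V0 by (rule eventually_nhds_in_open)
  have "\<forall>\<^sub>F s in nhds 0. deriv ?\<phi> s = \<phi>' s"
    using near by eventually_elim (rule DERIV_imp_deriv[OF 1])
  then have "deriv (deriv ?\<phi>) 0 = f'' (x, t) (b, 0)"
    using deriv_cong_ev DERIV_imp_deriv[OF 2] by metis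
  then have "(\<phi>' has_real_derivative (deriv ^^ 2) ?\<phi> 0) (at 0)"
    using 2 by (simp add: numeral_2_eq_2)
  moreover have "\<forall>\<^sub>F s in nhds 0. (?\<phi> has_real_derivative \<phi>' s) (at s)"
    using near by eventually_elim (rule 1)
  ultimately show thesis using that by blast
qed

text \<open>
  With \<open>\<beta> = x \<bullet> b\<close> the squares \<open>\<beta>\<^sup>2\<close> sum to \<open>|x|\<^sup>2\<close>, and the two derivatives at \<open>0\<close> add up to
  \<open>|\<nabla>\<eta>|\<^sup>2 = 16 |x|\<^sup>2 (1 - |x|\<^sup>2)\<^sup>2\<close> and \<open>\<Delta>\<eta> = 8 |x|\<^sup>2 - 4 n (1 - |x|\<^sup>2)\<close>.
\<close>

lemma cutoff_along_line:
  fixes x b :: "'a::euclidean_space" and m :: real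
  assumes b: "b \<in> Basis"
  defines "e \<equiv> \<lambda>s. (1 - (norm (x + s *\<^sub>R b))\<^sup>2)\<^sup>2 - m"
  obtains e' where "\<And>s. (e has_real_derivative e' s) (at s)"
    and "(e' has_real_derivative 8 * (x \<bullet> b)\<^sup>2 - 4 * (1 - (norm x)\<^sup>2)) (at 0)"
    and "e' 0 = - 4 * (x \<bullet> b) * (1 - (norm x)\<^sup>2)"
proof -
  let ?q = "\<lambda>s. 1 - (norm x)\<^sup>2 - 2 * s * (x \<bullet> b) - s\<^sup>2"
  let ?e' = "\<lambda>s. - 4 * ?q s * (x \<bullet> b + s)"
  have e: "e = (\<lambda>s. (?q s)\<^sup>2 - m)"
  proof
    fix s
    have "(norm (x + s *\<^sub>R b))\<^sup>2 = (norm x)\<^sup>2 + 2 * s * (x \<bullet> b) + s\<^sup>2"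
      using b unfolding power2_norm_eq_inner
      by (simp add: inner_simps inner_commute power2_eq_square)
    then show "e s = (?q s)\<^sup>2 - m" by (simp add: e_def algebra_simps)
  qed
  show thesis
  proof
    show "(e has_real_derivative ?e' s) (at s)" for s
      unfolding e by (auto intro!: derivative_eq_intros simp: algebra_simps)
    show "(?e' has_real_derivative 8 * (x \<bullet> b)\<^sup>2 - 4 * (1 - (norm x)\<^sup>2)) (at 0)"
      by (auto intro!: derivative_eq_intros simp: algebra_simps power2_eq_square)
  qed (simp add: algebra_simps)
qed

lemma decay_root_le:
  fixes p t y :: real
  assumes "p \<ge> 1" "0 \<le> t" "t \<le> 1" "0 \<le> y" "y * t powr p \<le> 1"
  shows "(y + 1) powr (1 / p) * t \<le> 2"
proof -
  have "t powr p \<le> 1" using powr_mono2[of p t 1] assms by simp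
  then have "(y + 1) * t powr p \<le> 2" using assms by (simp add: algebra_simps)
  then have "((y + 1) * t powr p) powr (1 / p) \<le> 2 powr (1 / p)"
    by (intro powr_mono2) (use assms in auto)
  also have "\<dots> \<le> 2 powr 1" by (rule powr_mono) (use assms in auto)
  finally show ?thesis using assms by (simp add: powr_mult powr_powr)
qed

section \<open>The maximum principle\<close>

text \<open>
  The time derivative gives \<open>F\<^sub>t / F \<ge> p M / \<eta>\<close>, the coordinate directions together give
  \<open>\<Delta>F / F \<le> (p\<^sup>2 + p) |\<nabla>\<eta>|\<^sup>2 / \<eta>\<^sup>2 - p \<Delta>\<eta> / \<eta>\<close>, and the heat equation identifies the two left-hand
  sides, which is the bound \<open>M \<le> (p + 1) |\<nabla>\<eta>|\<^sup>2 / \<eta> - \<Delta>\<eta>\<close>. The logarithm of \<open>u\<^sup>p\<close> is used because it separates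
  \<open>F\<close> from \<open>\<eta>\<close>.
\<close>

lemma heat_cutoff_max_inequality:
  fixes f :: "'a::euclidean_space \<Rightarrow> real \<Rightarrow> real" and M p :: real
  defines "\<eta> \<equiv> \<lambda>x t. (1 - (norm x)\<^sup>2)\<^sup>2 - M * t"
  assumes p: "p > 0"
    and f: "smooth_heat_solution U {0..1} f"
    and U: "open U" and V: "open V" "V \<subseteq> U" "x \<in> V"
    and t: "0 < t" "t \<le> 1"
    and fpos: "f x t + 1 > 0" and \<eta>pos: "\<eta> x t > 0"
    and max: "\<And>y s. y \<in> V \<Longrightarrow> s \<in> {0..1} \<Longrightarrow> \<eta> y s > 0 \<Longrightarrow>
       ln (f y s + 1) + p * ln (\<eta> y s) \<le> ln (f x t + 1) + p * ln (\<eta> x t)"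
  shows "M \<le> (p + 1) * (16 * (norm x)\<^sup>2 * (1 - (norm x)\<^sup>2)\<^sup>2) / \<eta> x t
      - (8 * (norm x)\<^sup>2 - 4 * real DIM('a) * (1 - (norm x)\<^sup>2))"
proof -
  let ?a = "(norm x)\<^sup>2" and ?L = "laplacian (\<lambda>y. f y t) x" and ?F = "f x t + 1" and ?e = "\<eta> x t"
  have tT: "t \<in> {0..1}" using t by simp
  have xU: "x \<in> U" using V by blast
  have C2: "Ck_on 2 (U \<times> {0..1}) (\<lambda>(x, t). f x t)"
    and ft: "((\<lambda>s. f x s) has_real_derivative ?L) (at t within {0..1})"
    using f xU tT unfolding smooth_heat_solution_def smooth_on_def by blast+
  have "0 \<le> ?L / ?F - p * M / ?e"
  proof (rule left_max_derivative_nonneg)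
    show "((\<lambda>s. ln (f x s + 1) + p * ln (\<eta> x s)) has_real_derivative ?L / ?F - p * M / ?e)
        (at t within {0..1})"
      using fpos \<eta>pos unfolding \<eta>_def
      by (auto intro!: derivative_eq_intros ft simp: divide_inverse)
    have "((\<lambda>s. \<eta> x s) \<longlongrightarrow> ?e) (at t within {0..1})"
      unfolding \<eta>_def by (auto intro!: tendsto_eq_intros)
    then have "\<forall>\<^sub>F s in at t within {0..1}. \<eta> x s > 0" using \<eta>pos by (rule order_tendstoD)
    moreover have "\<forall>\<^sub>F s in at t within {0..1}. s \<in> {0..1::real}"
      by (simp add: eventually_at_filter)
    ultimately show "\<forall>\<^sub>F s in at t within {0..1}.
        ln (f x s + 1) + p * ln (\<eta> x s) \<le> ln (f x t + 1) + p * ln (\<eta> x t)"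
      by eventually_elim (use max V in blast)
  qed (use t in auto)
  then have lower: "p * M / ?e \<le> ?L / ?F" by simp
  have dir: "(deriv ^^ 2) (\<lambda>s. f (x + s *\<^sub>R b) t) 0 / ?F
      \<le> (p\<^sup>2 + p) * (16 * (x \<bullet> b)\<^sup>2 * (1 - ?a)\<^sup>2) / ?e\<^sup>2 - p * (8 * (x \<bullet> b)\<^sup>2 - 4 * (1 - ?a)) / ?e"
    if b: "b \<in> Basis" for b
  proof -
    obtain \<phi>' where \<phi>: "\<forall>\<^sub>F s in nhds 0. ((\<lambda>s. f (x + s *\<^sub>R b) t) has_real_derivative \<phi>' s) (at s)"
      and \<phi>': "(\<phi>' has_real_derivative (deriv ^^ 2) (\<lambda>s. f (x + s *\<^sub>R b) t) 0) (at 0)"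
      by (rule Ck_on_spatial_line[OF C2 U xU tT])
    have \<phi>1: "\<forall>\<^sub>F s in nhds 0. ((\<lambda>s. f (x + s *\<^sub>R b) t + 1) has_real_derivative \<phi>' s) (at s)"
      using \<phi> by eventually_elim (auto intro!: derivative_eq_intros)
    obtain e' where e: "\<And>s. ((\<lambda>s. \<eta> (x + s *\<^sub>R b) t) has_real_derivative e' s) (at s)"
      and e': "(e' has_real_derivative 8 * (x \<bullet> b)\<^sup>2 - 4 * (1 - ?a)) (at 0)"
      and e0: "e' 0 = - 4 * (x \<bullet> b) * (1 - ?a)"
      by (rule cutoff_along_line[OF b, of x "M * t"]) (rule that[unfolded \<eta>_def])
    have "\<forall>\<^sub>F s in nhds 0. x + s *\<^sub>R b \<in> V"
    proof -
      have "open ((\<lambda>s::real. x + s *\<^sub>R b) -` V)" by (intro open_vimage V continuous_intros)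
      from eventually_nhds_in_open[OF this, of 0] V show ?thesis by simp
    qed
    moreover have "isCont (\<lambda>s. \<eta> (x + s *\<^sub>R b) t) 0" using e by (rule DERIV_isCont)
    then have "\<forall>\<^sub>F s in nhds 0. \<eta> (x + s *\<^sub>R b) t > 0"
      by (rule isCont_eventually_pos) (use \<eta>pos in simp)
    ultimately have mx: "\<forall>\<^sub>F s in nhds 0.
        ln (f (x + s *\<^sub>R b) t + 1) + p * ln (\<eta> (x + s *\<^sub>R b) t)
        \<le> ln (f (x + 0 *\<^sub>R b) t + 1) + p * ln (\<eta> (x + 0 *\<^sub>R b) t)"
      by eventually_elim (use max tT in simp)
    show ?thesis
      using log_second_derivative_le[OF \<phi>1 \<phi>' e e' _ _ mx] fpos \<eta>pos
      by (simp add: e0 power_divide power_mult_distrib)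
  qed
  have S: "(\<Sum>b\<in>Basis. (x \<bullet> b)\<^sup>2) = ?a" 
    unfolding power2_norm_eq_inner by (subst euclidean_inner) (simp add: power2_eq_square)
  have "?L / ?F \<le> (\<Sum>b\<in>Basis. (p\<^sup>2 + p) * (16 * (x \<bullet> b)\<^sup>2 * (1 - ?a)\<^sup>2) / ?e\<^sup>2
      - p * (8 * (x \<bullet> b)\<^sup>2 - 4 * (1 - ?a)) / ?e)"
    unfolding laplacian_def sum_divide_distrib by (intro sum_mono dir)
  also have "\<dots> = (\<Sum>b\<in>Basis. (x \<bullet> b)\<^sup>2 * (((p\<^sup>2 + p) * 16 * (1 - ?a)\<^sup>2) / ?e\<^sup>2 - 8 * p / ?e)
      + 4 * p * (1 - ?a) / ?e)"
    by (intro sum.cong refl) (simp add: algebra_simps diff_divide_distrib add_divide_distrib)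
  also have "\<dots> = ?a * (((p\<^sup>2 + p) * 16 * (1 - ?a)\<^sup>2) / ?e\<^sup>2 - 8 * p / ?e)
      + real DIM('a) * (4 * p * (1 - ?a) / ?e)"
    by (simp add: sum.distrib S flip: sum_distrib_right)
  also have "\<dots> = p / ?e * ((p + 1) * (16 * ?a * (1 - ?a)\<^sup>2) / ?e - (8 * ?a - 4 * real DIM('a) * (1 - ?a)))"
    using \<eta>pos by (simp add: field_simps power2_eq_square)
  finally have "p / ?e * M
      \<le> p / ?e * ((p + 1) * (16 * ?a * (1 - ?a)\<^sup>2) / ?e - (8 * ?a - 4 * real DIM('a) * (1 - ?a)))"
    using lower by simp
  moreover have "p / ?e > 0" using p \<eta>pos by simp
  ultimately show ?thesis by (simp only: mult_le_cancel_left_pos)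
qed

lemma heat_cutoff_bound:
  fixes f :: "'a::euclidean_space \<Rightarrow> real \<Rightarrow> real" and p :: real
  defines "M \<equiv> 32 * (p + 1) + 4 * real DIM('a) + 1"
  assumes p: "p \<ge> 1"
    and f: "smooth_heat_solution (ball 0 2) {0..1} f"
    and decay: "\<And>x t. x \<in> ball 0 1 \<Longrightarrow> t \<in> {0..1} \<Longrightarrow> f x t * t powr p \<le> 1"
    and nonneg: "\<And>x t. x \<in> ball 0 2 \<Longrightarrow> t \<in> {0..1} \<Longrightarrow> f x t \<ge> 0"
    and init: "\<And>x. x \<in> cball 0 1 \<Longrightarrow> (f x 0 + 1) powr (1 / p) * (1 - (norm x)\<^sup>2)\<^sup>2 \<le> 2"
    and xt: "x \<in> cball 0 1" "t \<in> {0..1}"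
  shows "(f x t + 1) powr (1 / p) * ((1 - (norm x)\<^sup>2)\<^sup>2 - M * t) \<le> 2 * M"
proof (rule ccontr)
  assume big: "\<not> ?thesis"
  define \<eta> where "\<eta> = (\<lambda>(x::'a) t. (1 - (norm x)\<^sup>2)\<^sup>2 - M * t)"
  define u where "u = (\<lambda>z. (f (fst z) (snd z) + 1) powr (1 / p) * \<eta> (fst z) (snd z))"
  let ?K = "cball (0::'a) 1 \<times> {0..1::real}"
  have M: "M \<ge> 1" using p by (simp add: M_def)
  have sub: "?K \<subseteq> ball 0 2 \<times> {0..1}" by auto
  have fpos: "f y s + 1 > 0" if "norm y \<le> 1" "s \<in> {0..1}" for y s
    using nonneg[of y s] that by simp
  have "continuous_on (ball 0 2 \<times> {0..1}) (\<lambda>(x, t). f x t)"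
    using f unfolding smooth_heat_solution_def smooth_on_def by (metis Ck_on.simps(1))
  then have "continuous_on ?K (\<lambda>z. f (fst z) (snd z))"
    using sub by (auto simp: case_prod_unfold elim: continuous_on_subset)
  then have cont: "continuous_on ?K u"
    unfolding u_def \<eta>_def
    by (intro continuous_intros ballI) (use fpos in \<open>auto simp: less_imp_neq[symmetric]\<close>)
  have "compact ?K" by (intro compact_Times compact_cball compact_Icc)
  moreover have "?K \<noteq> {}" using xt by blast
  ultimately obtain z where z: "z \<in> ?K" and zmax: "\<And>w. w \<in> ?K \<Longrightarrow> u w \<le> u z"
    using continuous_attains_sup[OF _ _ cont] by blast
  obtain x0 t0 where z_eq: "z = (x0, t0)" by (cases z)
  have x0: "norm x0 \<le> 1" and t0: "t0 \<in> {0..1}" using z by (auto simp: z_eq)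
  let ?g = "(f x0 t0 + 1) powr (1 / p)" and ?e = "\<eta> x0 t0"
  have large: "?g * ?e > 2 * M"
    using big zmax[of "(x, t)"] xt by (simp add: u_def z_eq \<eta>_def)
  have gpos: "?g > 0" using fpos[OF x0 t0] by simp
  have epos: "?e > 0" using zero_less_mult_pos[of ?g ?e] large M gpos by linarith
  have "norm x0 \<noteq> 1"
  proof
    assume "norm x0 = 1"
    then have "?e = - (M * t0)" by (simp add: \<eta>_def)
    moreover have "M * t0 \<ge> 0" using M t0 by simp
    ultimately show False using epos by simp
  qed
  with x0 have x1: "norm x0 < 1" by simp
  have "t0 \<noteq> 0" using large init[of x0] x0 M by (auto simp: \<eta>_def)
  with t0 have tpos: "0 < t0" "t0 \<le> 1" by auto
  have lmax: "ln (f y s + 1) + p * ln (\<eta> y s) \<le> ln (f x0 t0 + 1) + p * ln ?e"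
    if y: "y \<in> ball 0 1" and s: "s \<in> {0..1}" and pos: "\<eta> y s > 0" for y s
  proof -
    have F: "f y s + 1 > 0" "f x0 t0 + 1 > 0" using fpos y s x0 t0 by auto
    have "ln ((f y s + 1) powr (1 / p) * \<eta> y s) \<le> ln (?g * ?e)"
      using zmax[of "(y, s)"] y s F pos gpos epos by (intro ln_mono) (auto simp: u_def z_eq)
    then have "1 / p * ln (f y s + 1) + ln (\<eta> y s) \<le> 1 / p * ln (f x0 t0 + 1) + ln ?e"
      using F pos epos by (simp add: ln_mult ln_powr)
    then have "p * (1 / p * ln (f y s + 1) + ln (\<eta> y s)) \<le> p * (1 / p * ln (f x0 t0 + 1) + ln ?e)"
      using p by (intro mult_left_mono) auto
    then show ?thesis using p by (simp add: distrib_left)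
  qed
  let ?a = "(norm x0)\<^sup>2"
  have a: "0 \<le> ?a" "?a \<le> 1" using x0 by (auto simp: power_le_one)
  have ineq: "M \<le> (p + 1) * (16 * ?a * (1 - ?a)\<^sup>2) / ?e - (8 * ?a - 4 * real DIM('a) * (1 - ?a))"
    unfolding \<eta>_def
    by (rule heat_cutoff_max_inequality[where V = "ball 0 1", OF _ f])
      (use p x1 tpos fpos[OF x0 t0] epos lmax in \<open>auto simp: \<eta>_def\<close>)
  \<comment> \<open>At a point where \<open>u\<close> is large, the decay in time keeps \<open>\<eta>\<close> comparable with \<open>(1 - |x|\<^sup>2)\<^sup>2\<close>.\<close>
  have "?g * t0 \<le> 2"
    using decay_root_le[of p t0 "f x0 t0"] p tpos decay[of x0 t0] nonneg[of x0 t0] x1 by auto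
  then have "?e * (?g * t0) \<le> ?e * 2" using epos by (intro mult_left_mono) auto
  moreover have "2 * M * t0 < ?g * ?e * t0" using large tpos by simp
  ultimately have Mt: "M * t0 \<le> ?e" by (simp add: mult_ac)
  have "(1 - ?a)\<^sup>2 = ?e + M * t0" by (simp add: \<eta>_def)
  then have "16 * ?a * (1 - ?a)\<^sup>2 \<le> 16 * 1 * (2 * ?e)"
    using Mt a zero_le_power2[of "1 - ?a"] by (intro mult_mono) auto
  then have "(p + 1) * (16 * ?a * (1 - ?a)\<^sup>2) / ?e \<le> (p + 1) * (32 * ?e) / ?e"
    using p epos by (intro divide_right_mono mult_left_mono) auto
  also have "\<dots> = 32 * (p + 1)" using epos by simp
  finally have "(p + 1) * (16 * ?a * (1 - ?a)\<^sup>2) / ?e \<le> 32 * (p + 1)" .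
  moreover have "4 * real DIM('a) * (1 - ?a) \<le> 4 * real DIM('a) * 1"
    using a by (intro mult_left_mono) auto
  ultimately show False using ineq a unfolding M_def by linarith
qed

text \<open>
  The initial supremum bounds each value because the function is continuous on the compact ball;
  a supremum of an unbounded family would carry no information.
\<close>

theorem lemma2p2:
  fixes p :: real
  assumes "p \<ge> 1"
  shows "\<exists>M c :: real. \<forall>f :: real ^ 'n \<Rightarrow> real \<Rightarrow> real.
    smooth_heat_solution (ball 0 2) {0..1} f \<longrightarrow>
    (\<forall>x \<in> ball 0 1. \<forall>t \<in> {0..1}. f x t * t powr p \<le> 1) \<longrightarrow>
    (\<forall>x \<in> ball 0 2. \<forall>t \<in> {0..1}. f x t \<ge> 0) \<longrightarrow>
    (SUP x \<in> cball 0 1. (f x 0 + 1) powr (1 / p) * (1 - (norm x)\<^sup>2)\<^sup>2) \<le> 2 \<longrightarrow>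
    (\<forall>t \<in> {0..1}.
      (SUP x \<in> cball 0 1. (f x t + 1) powr (1 / p) * ((1 - (norm x)\<^sup>2)\<^sup>2 - M * t)) \<le> c)"
proof -
  let ?M = "32 * (p + 1) + 4 * real DIM(real ^ 'n) + 1"
  show ?thesis
  proof (rule exI[of _ ?M], rule exI[of _ "2 * ?M"], intro allI impI ballI)
    fix f :: "real ^ 'n \<Rightarrow> real \<Rightarrow> real" and t :: real
    assume f: "smooth_heat_solution (ball 0 2) {0..1} f"
      and decay: "\<forall>x \<in> ball 0 1. \<forall>t \<in> {0..1}. f x t * t powr p \<le> 1"
      and nonneg: "\<forall>x \<in> ball 0 2. \<forall>t \<in> {0..1}. f x t \<ge> 0"
      and init: "(SUP x \<in> cball 0 1. (f x 0 + 1) powr (1 / p) * (1 - (norm x)\<^sup>2)\<^sup>2) \<le> 2"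
      and t: "t \<in> {0..1}"
    let ?u0 = "\<lambda>x. (f x 0 + 1) powr (1 / p) * (1 - (norm x)\<^sup>2)\<^sup>2"
    have pos: "f x 0 + 1 > 0" if "norm x \<le> 1" for x
      using nonneg[rule_format, of x 0] that by simp
    have c: "continuous_on (ball 0 2 \<times> {0..1}) (\<lambda>(x, t). f x t)"
      using f unfolding smooth_heat_solution_def smooth_on_def by (metis Ck_on.simps(1))
    have "continuous_on (cball 0 1) (\<lambda>x. (\<lambda>(x, t). f x t) (x, 0))"
      by (rule continuous_on_compose2[OF c]) (auto intro!: continuous_intros)
    then have "continuous_on (cball 0 1) ?u0"
      by (intro continuous_intros ballI) (use pos in \<open>auto simp: less_imp_neq[symmetric]\<close>)
    then have "bdd_above (?u0 ` cball 0 1)"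
      by (intro bounded_imp_bdd_above compact_imp_bounded compact_continuous_image compact_cball)
    then have init': "?u0 x \<le> 2" if "x \<in> cball 0 1" for x
      using cSUP_upper[OF that] init by (meson order_trans)
    show "(SUP x \<in> cball 0 1. (f x t + 1) powr (1 / p) * ((1 - (norm x)\<^sup>2)\<^sup>2 - ?M * t)) \<le> 2 * ?M"
      by (rule cSUP_least) (use heat_cutoff_bound[OF assms f] decay nonneg init' t in auto)
  qed
qed

end
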